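(* If an algorithm for online out-forest precedence constraints satisfies at every time $t$ and for every $j\in F_t$ that $w(S(j))\le\rho\cdot R_j^t\cdot W(t)$, where $R_j^t$ is the processing rate of $j$ at time $t$, then it is at most $4\rho$-competitive for minimizing the total weighted completion time on a single machine.
   Context: Problem (non-clairvoyant single-machine scheduling with online precedence constraints): jobs $J$ with processing requirements $p_j\ge0$ and weights $w_j\ge0$, precedence DAG $G=(J,E)$ ($(j',j)\in E$ means $j$ may start only after $j'$ completes). Time is discrete; a preemptive schedule assigns rates $R_j^t\ge0$ with $\sum_jR_j^t\le1$; $C_j$ is the first $t$ with $\sum_{t'\le t}R_j^{t'}\ge p_j$. Front jobs: $F_t=\{j: C_j>t,\ C_{j'}<t\ \forall(j',j)\in E\}$, and only front jobs may receive positive rate. Jobs are revealed online when all predecessors are completed; the algorithm does not know processing requirements or $G$. Objective: minimize $\sum_jw_jC_j$; $\rho'$-competitive means $\mathrm{Alg}\le\rho'\cdot\mathrm{Opt}$ on all instances, $\mathrm{Opt}$ being the offline optimum. $G$ is an out-forest if every job has at most one incoming edge. $S(v)$ denotes $v$ together with all its successors, $w(X)=\sum_{u\in X}w_u$, $U_t=\bigcup_{v\in F_t}S(v)$ is the set of unfinished jobs at time $t$, and $W(t)=w(U_t)$.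
   Formalization: Front jobs are those with C_j ≥ t (not C_j > t, under which no job with p_j > 0 could ever complete), and a job, in particular one with p_j = 0, counts as complete only once all its predecessors are complete. *)

theory Defs
  imports Complex_Main "HOL-Library.Extended_Nonnegative_Real"
begin

record 'j sched_instance =
  jobs :: "'j set"
  proc :: "'j \<Rightarrow> real"
  weight :: "'j \<Rightarrow> real"
  prec :: "('j \<times> 'j) set"

definition valid_instance :: "'j sched_instance \<Rightarrow> bool" where
  "valid_instance I \<longleftrightarrow>
     finite (jobs I) \<and>
     (\<forall>j\<in>jobs I. 0 \<le> proc I j \<and> 0 \<le> weight I j) \<and>
     prec I \<subseteq> jobs I \<times> jobs I \<and> acyclic (prec I)"

definition out_forest :: "'j sched_instance \<Rightarrow> bool" where
  "out_forest I \<longleftrightarrow>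
     valid_instance I \<and> (\<forall>i i' j. (i, j) \<in> prec I \<longrightarrow> (i', j) \<in> prec I \<longrightarrow> i = i')"

text \<open>
  A rate assignment \<open>R\<close> gives job \<open>j\<close> the rate \<open>R j t\<close> in the time slot
  \<open>t = 1, 2, \<dots>\<close>; the value at \<open>t = 0\<close> is never used.
\<close>

type_synonym 'j rates = "'j \<Rightarrow> nat \<Rightarrow> real"

text \<open>
  The completion time is the first \<open>t\<close> at which the total rate received reaches the processing
  requirement. The quantification over the predecessors of \<open>j\<close> matters only for jobs with
  requirement 0, which would otherwise complete at time 0 before their predecessors; for all other
  jobs it is redundant, see \<open>completion_time_pos\<close> below. The value is \<open>\<infinity>\<close> if the job never completes.
\<close>

definition completion_time :: "'j sched_instance \<Rightarrow> 'j rates \<Rightarrow> 'j \<Rightarrow> enat" where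
  "completion_time I R j =
     Inf {enat t | t. \<forall>i. (i, j) \<in> (prec I)\<^sup>* \<longrightarrow> proc I i \<le> (\<Sum>s\<in>{1..t}. R i s)}"

text \<open>
  A job that receives its last unit of processing in slot \<open>t\<close> has completion time \<open>t\<close>, and it
  has to be a front job in slot \<open>t\<close>; hence the non-strict inequality.
\<close>

definition front :: "'j sched_instance \<Rightarrow> 'j rates \<Rightarrow> nat \<Rightarrow> 'j set" where
  "front I R t =
     {j \<in> jobs I. enat t \<le> completion_time I R j \<and>
        (\<forall>i. (i, j) \<in> prec I \<longrightarrow> completion_time I R i < enat t)}"

definition schedule :: "'j sched_instance \<Rightarrow> 'j rates \<Rightarrow> bool" where
  "schedule I R \<longleftrightarrow>
     (\<forall>t\<ge>1. (\<forall>j. 0 \<le> R j t) \<and> (\<Sum>j\<in>jobs I. R j t) \<le> 1 \<and>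
        (\<forall>j. 0 < R j t \<longrightarrow> j \<in> front I R t))"

definition succs :: "'j sched_instance \<Rightarrow> 'j \<Rightarrow> 'j set" where
  "succs I v = {u. (v, u) \<in> (prec I)\<^sup>*}"

definition unfinished :: "'j sched_instance \<Rightarrow> 'j rates \<Rightarrow> nat \<Rightarrow> 'j set" where
  "unfinished I R t = (\<Union>v\<in>front I R t. succs I v)"

definition total_weight :: "'j sched_instance \<Rightarrow> 'j set \<Rightarrow> real" where
  "total_weight I X = (\<Sum>u\<in>X. weight I u)"

definition cost :: "'j sched_instance \<Rightarrow> 'j rates \<Rightarrow> ennreal" where
  "cost I R = (\<Sum>j\<in>jobs I. ennreal (weight I j) * ennreal_of_enat (completion_time I R j))"

definition opt :: "'j sched_instance \<Rightarrow> ennreal" where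
  "opt I = Inf {cost I R | R. schedule I R}"

definition revealed :: "'j sched_instance \<Rightarrow> 'j rates \<Rightarrow> nat \<Rightarrow> 'j set" where
  "revealed I R t = {j \<in> jobs I. \<forall>i. (i, j) \<in> prec I \<longrightarrow> completion_time I R i < enat t}"

definition finished :: "'j sched_instance \<Rightarrow> 'j rates \<Rightarrow> nat \<Rightarrow> 'j set" where
  "finished I R t = {j \<in> jobs I. completion_time I R j < enat t}"

text \<open>
  What is observable before the rates of slot \<open>t\<close> are chosen: which jobs were revealed and
  which were finished at each earlier point, and the weights of the revealed jobs.
\<close>

definition same_history ::
  "nat \<Rightarrow> 'j sched_instance \<Rightarrow> 'j rates \<Rightarrow> 'j sched_instance \<Rightarrow> 'j rates \<Rightarrow> bool" where
  "same_history t I R I' R' \<longleftrightarrow>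
     (\<forall>s\<in>{1..t}. revealed I R s = revealed I' R' s \<and> finished I R s = finished I' R' s) \<and>
     (\<forall>j\<in>revealed I R t. weight I j = weight I' j)"

text \<open>
  A deterministic non-clairvoyant online algorithm on a class of instances: it outputs a schedule
  for each instance, and its rates in slot \<open>t\<close> depend only on the observable history, not on
  processing requirements or on the precedence graph.
\<close>

definition online_algorithm ::
  "'j sched_instance set \<Rightarrow> ('j sched_instance \<Rightarrow> 'j rates) \<Rightarrow> bool" where
  "online_algorithm \<I> A \<longleftrightarrow>
     (\<forall>I\<in>\<I>. schedule I (A I)) \<and>
     (\<forall>I\<in>\<I>. \<forall>I'\<in>\<I>. \<forall>t\<ge>1. same_history t I (A I) I' (A I') \<longrightarrow> (\<forall>j. A I j t = A I' j t))"

definition competitive ::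
  "'j sched_instance set \<Rightarrow> ('j sched_instance \<Rightarrow> 'j rates) \<Rightarrow> real \<Rightarrow> bool" where
  "competitive \<I> A c \<longleftrightarrow> (\<forall>I\<in>\<I>. cost I (A I) \<le> ennreal c * opt I)"

lemma completion_time_le_iff:
  assumes "schedule I R"
  shows "completion_time I R j \<le> enat t \<longleftrightarrow>
    (\<forall>i. (i, j) \<in> (prec I)\<^sup>* \<longrightarrow> proc I i \<le> (\<Sum>s\<in>{1..t}. R i s))" (is "_ \<longleftrightarrow> ?P t")
proof
  assume "?P t"
  then show "completion_time I R j \<le> enat t"
    unfolding completion_time_def by (intro Inf_lower) blast
next
  assume le: "completion_time I R j \<le> enat t"
  let ?S = "{enat t | t. ?P t}"
  have ne: "?S \<noteq> {}"
  proof
    assume "?S = {}"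
    with le show False unfolding completion_time_def by (simp only: Inf_enat_def) simp
  qed
  then have "Inf ?S \<in> ?S"
    by (rule wellorder_InfI[OF some_in_eq[THEN iffD2]])
  then obtain t' where t': "completion_time I R j = enat t'" "?P t'"
    unfolding completion_time_def by auto
  with le have "t' \<le> t" by simp
  have mono: "(\<Sum>s\<in>{1..t'}. R i s) \<le> (\<Sum>s\<in>{1..t}. R i s)" for i
    using \<open>t' \<le> t\<close> assms by (intro sum_mono2) (auto simp: schedule_def)
  show "?P t" using t'(2) mono by (meson order_trans)
qed

lemma completion_time_pos:
  assumes R: "schedule I R" and pos: "0 < proc I j"
  shows "completion_time I R j = Inf {enat t | t. proc I j \<le> (\<Sum>s\<in>{1..t}. R j s)}"
proof -
  have "proc I i \<le> (\<Sum>s\<in>{1..t}. R i s)"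
    if le: "proc I j \<le> (\<Sum>s\<in>{1..t}. R j s)" and ij: "(i, j) \<in> (prec I)\<^sup>*" for i t
  proof (cases "i = j")
    case False
    then obtain k where k: "(i, k) \<in> (prec I)\<^sup>*" "(k, j) \<in> prec I"
      using ij by (meson rtranclE)
    have "\<exists>s\<in>{1..t}. 0 < R j s"
    proof (rule ccontr)
      assume "\<not> ?thesis"
      then have "(\<Sum>s\<in>{1..t}. R j s) \<le> 0" by (intro sum_nonpos) force
      with le pos show False by linarith
    qed
    then obtain s where s: "s \<in> {1..t}" "0 < R j s" by blast
    with R have "j \<in> front I R s" unfolding schedule_def by auto
    with k have "completion_time I R k < enat s" unfolding front_def by blast
    also have "enat s \<le> enat t" using s by simp
    finally have "completion_time I R k \<le> enat t" by simp
    with k show ?thesis using completion_time_le_iff[OF R] by blast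
  qed (use le in simp)
  then have "{enat t | t. \<forall>i. (i, j) \<in> (prec I)\<^sup>* \<longrightarrow> proc I i \<le> (\<Sum>s\<in>{1..t}. R i s)} =
      {enat t | t. proc I j \<le> (\<Sum>s\<in>{1..t}. R j s)}"
    by blast
  then show ?thesis unfolding completion_time_def by simp
qed

lemma completion_time_mono:
  assumes "(i, j) \<in> (prec I)\<^sup>*"
  shows "completion_time I R i \<le> completion_time I R j"
  unfolding completion_time_def using assms
  by (intro Inf_superset_mono) (blast intro: rtrancl_trans)

lemma unfinished_eq:
  assumes "valid_instance I"
  shows "unfinished I R t = {j \<in> jobs I. enat t \<le> completion_time I R j}"
proof (intro set_eqI iffI)
  fix j assume "j \<in> unfinished I R t"
  then obtain v where v: "v \<in> front I R t" "(v, j) \<in> (prec I)\<^sup>*"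
    unfolding unfinished_def succs_def by blast
  have "j \<in> jobs I"
    using v(2,1) assms by (cases rule: rtranclE) (auto simp: front_def valid_instance_def)
  moreover have "enat t \<le> completion_time I R j"
    using v completion_time_mono[OF v(2)] unfolding front_def by (blast intro: order_trans)
  ultimately show "j \<in> {j \<in> jobs I. enat t \<le> completion_time I R j}" by blast
next
  fix j assume j: "j \<in> {j \<in> jobs I. enat t \<le> completion_time I R j}"
  have "finite (prec I)"
    using assms unfolding valid_instance_def by (meson finite_SigmaI finite_subset)
  then have "wf (prec I)"
    using assms by (auto intro: finite_acyclic_wf simp: valid_instance_def)
  then show "j \<in> unfinished I R t" using j
  proof (induction j)
    case (less j)
    show ?case
    proof (cases "j \<in> front I R t")
      case True
      then show ?thesis unfolding unfinished_def succs_def by blast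
    next
      case False
      with less.prems obtain i where i: "(i, j) \<in> prec I" "enat t \<le> completion_time I R i"
        unfolding front_def by (auto simp: not_less)
      moreover from i assms have "i \<in> jobs I" unfolding valid_instance_def by blast
      ultimately have "i \<in> unfinished I R t" using less.IH by blast
      with i(1) show ?thesis
        unfolding unfinished_def succs_def by (blast intro: rtrancl.rtrancl_into_rtrancl)
    qed
  qed
qed

end

theory Submission
  imports Defs
begin

text \<open>
  Fix a time \<open>t\<close> and split \<open>W(t) = W\<^sub>N(t) + W\<^sub>L(t)\<close>, where \<open>W\<^sub>L\<close> collects the subtrees \<open>S(v)\<close>
  of the front jobs \<open>v\<close> that complete exactly at \<open>t\<close> and may therefore receive more than they need.
  Let \<open>C\<^sup>*\<close> be the completion times of a competing schedule.

  A job \<open>u\<close> is counted in \<open>W\<^sub>L\<close> at most once per ancestor with positive requirement. In every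
  schedule these ancestors complete in distinct slots, so \<open>\<Sum>\<^sub>t W\<^sub>L(t) \<le> \<Sum>\<^sub>u w\<^sub>u C\<^sup>*\<^sub>u\<close>.

  The front jobs in \<open>W\<^sub>N\<close> waste nothing, and \<open>C\<^sup>*\<^sub>u\<close> is at least the total requirement of the jobs
  \<open>v\<close> with \<open>C\<^sup>*\<^sub>v \<le> C\<^sup>*\<^sub>u\<close>. Distributing each requirement over the slots of the algorithm and using
  \<open>R\<^sub>v \<ge> w(S(v)) / (\<rho> W)\<close>, slot \<open>t\<close> contributes to \<open>\<Sum>\<^sub>u w\<^sub>u C\<^sup>*\<^sub>u\<close> at least the sum of
  \<open>w(S(v)) w(S(v')) / (\<rho> W)\<close> over the pairs with \<open>C\<^sup>*\<^sub>v \<le> C\<^sup>*\<^sub>v\<^sub>'\<close>, which is at least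
  \<open>W\<^sub>N\<^sup>2 / (2 \<rho> W)\<close>.

  Finally \<open>W \<le> W\<^sub>N\<^sup>2 / W + 2 W\<^sub>L\<close>, which gives the ratio \<open>2 \<rho> + 2 \<le> 4 \<rho>\<close>, because the
  hypothesis forces \<open>\<rho> \<ge> 1\<close> unless the cost is 0.
\<close>

section \<open>Front jobs by completion and the order of completion times\<close>

definition active :: "'j sched_instance \<Rightarrow> 'j rates \<Rightarrow> nat \<Rightarrow> 'j set" where
  "active I R t = {v \<in> front I R t. enat t < completion_time I R v}"

definition completing :: "'j sched_instance \<Rightarrow> 'j rates \<Rightarrow> nat \<Rightarrow> 'j set" where
  "completing I R t = {v \<in> front I R t. completion_time I R v = enat t}"

text \<open>Every ancestor other than \<open>j\<close> itself is a direct predecessor of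
  \<open>j\<close> or an ancestor of one. Knowing when the direct predecessors complete therefore
  settles the quantifier over all ancestors in \<open>completion_time\<close>.\<close>

lemma completion_time_le_if_preds:
  assumes R: "schedule I R"
    and preds: "\<And>i. (i, j) \<in> prec I \<Longrightarrow> completion_time I R i \<le> enat t"
    and own: "proc I j \<le> (\<Sum>s\<in>{1..t}. R j s)"
  shows "completion_time I R j \<le> enat t"
proof -
  have "proc I i \<le> (\<Sum>s\<in>{1..t}. R i s)" if "(i, j) \<in> (prec I)\<^sup>*" for i
    using that
  proof (cases rule: rtranclE)
    case base
    then show ?thesis using own by simp
  next
    case (step k)
    then show ?thesis using preds completion_time_le_iff[OF R, of k t] by blast
  qed
  then show ?thesis using completion_time_le_iff[OF R] by blast
qed

text \<open>A positive requirement forces a slot in which \<open>u\<close> runs, no later than its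
  completion. There \<open>u\<close> is a front job, so its ancestors completed strictly earlier.
  With requirement 0, \<open>u\<close> could complete together with a predecessor.\<close>

lemma completion_time_strict_mono:
  assumes R: "schedule I R" and vu: "(v, u) \<in> (prec I)\<^sup>+"
    and pos: "0 < proc I u" and fin: "completion_time I R u \<noteq> \<infinity>"
  shows "completion_time I R v < completion_time I R u"
proof -
  obtain t where t: "completion_time I R u = enat t" using fin by auto
  then have le: "proc I u \<le> (\<Sum>s\<in>{1..t}. R u s)"
    using completion_time_le_iff[OF R, of u t] by auto
  have "\<exists>s\<in>{1..t}. 0 < R u s"
  proof (rule ccontr)
    assume "\<not> ?thesis"
    then have "(\<Sum>s\<in>{1..t}. R u s) \<le> 0" by (intro sum_nonpos) force
    with le pos show False by linarith
  qed
  then obtain s where s: "s \<in> {1..t}" "0 < R u s" by blast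
  then have front: "u \<in> front I R s" using R by (auto simp: schedule_def)
  obtain k where k: "(v, k) \<in> (prec I)\<^sup>*" "(k, u) \<in> prec I"
    using vu by (meson tranclD2)
  have "completion_time I R v \<le> completion_time I R k" using k(1) by (rule completion_time_mono)
  also have "\<dots> < enat s" using front k(2) by (auto simp: front_def)
  also have "\<dots> \<le> completion_time I R u" using s t by simp
  finally show ?thesis .
qed

section \<open>Disjoint subtrees in an out-forest\<close>

text \<open>With at most one incoming edge per job, the way up from \<open>u\<close> is
  deterministic, so both ancestors lie on one path.\<close>

lemma out_forest_ancestors_comparable:
  assumes "out_forest I" "(v, u) \<in> (prec I)\<^sup>*" "(v', u) \<in> (prec I)\<^sup>*"
  shows "(v, v') \<in> (prec I)\<^sup>* \<or> (v', v) \<in> (prec I)\<^sup>*"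
proof -
  have "single_valued ((prec I)\<inverse>)"
    using assms(1) by (auto simp: out_forest_def single_valued_def)
  from single_valued_confluent[OF this, of u v v'] assms show ?thesis
    by (auto simp: rtrancl_converse)
qed

text \<open>A common descendant would make the two front jobs comparable. But a proper descendant of
  an unfinished job has an unfinished direct predecessor, hence is not a front job.\<close>

lemma succs_front_disjoint:
  assumes "out_forest I" and "v \<in> front I R t" "v' \<in> front I R t" "v \<noteq> v'"
  shows "succs I v \<inter> succs I v' = {}"
proof (rule ccontr)
  have no_ancestor: False
    if xy: "x \<in> front I R t" "y \<in> front I R t" "x \<noteq> y" "(x, y) \<in> (prec I)\<^sup>*" for x y
  proof -
    obtain k where k: "(x, k) \<in> (prec I)\<^sup>*" "(k, y) \<in> prec I"
      using xy(3,4) by (meson rtranclE)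
    have "enat t \<le> completion_time I R x" using xy by (auto simp: front_def)
    also have "\<dots> \<le> completion_time I R k" using k(1) by (rule completion_time_mono)
    also have "\<dots> < enat t" using k(2) xy by (auto simp: front_def)
    finally show False by simp
  qed
  assume "succs I v \<inter> succs I v' \<noteq> {}"
  then obtain u where "(v, u) \<in> (prec I)\<^sup>*" "(v', u) \<in> (prec I)\<^sup>*"
    by (auto simp: succs_def)
  from out_forest_ancestors_comparable[OF assms(1) this] show False
    using no_ancestor[OF assms(2,3)] no_ancestor[OF assms(3,2)] assms(4) by auto
qed

lemma succs_subset_jobs:
  assumes "valid_instance I" "v \<in> jobs I"
  shows "succs I v \<subseteq> jobs I"
proof
  fix u assume "u \<in> succs I v"
  then have "(v, u) \<in> (prec I)\<^sup>*" by (simp add: succs_def)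
  then show "u \<in> jobs I"
    by (cases rule: rtranclE) (use assms in \<open>auto simp: valid_instance_def\<close>)
qed

lemma total_weight_UN_succs:
  assumes f: "out_forest I" and X: "X \<subseteq> front I R t"
  shows "total_weight I (\<Union>v\<in>X. succs I v) = (\<Sum>v\<in>X. total_weight I (succs I v))"
proof -
  have val: "valid_instance I" using f by (simp add: out_forest_def)
  then have fin: "finite (jobs I)" by (simp add: valid_instance_def)
  have XJ: "X \<subseteq> jobs I" using X by (auto simp: front_def)
  show ?thesis unfolding total_weight_def
  proof (rule sum.UNION_disjoint)
    show "finite X" using XJ fin finite_subset by blast
    show "\<forall>v\<in>X. finite (succs I v)"
      using XJ fin succs_subset_jobs[OF val] by (meson finite_subset subsetD)
    show "\<forall>i\<in>X. \<forall>j\<in>X. i \<noteq> j \<longrightarrow> succs I i \<inter> succs I j = {}"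
      using succs_front_disjoint[OF f] X by blast
  qed
qed

lemma total_weight_nonneg:
  assumes "valid_instance I" "X \<subseteq> jobs I"
  shows "0 \<le> total_weight I X"
  unfolding total_weight_def using assms by (intro sum_nonneg) (auto simp: valid_instance_def)

lemma total_weight_mono:
  assumes "valid_instance I" "Y \<subseteq> jobs I" "X \<subseteq> Y"
  shows "total_weight I X \<le> total_weight I Y"
  unfolding total_weight_def using assms
  by (intro sum_mono2) (auto simp: valid_instance_def intro: finite_subset)

section \<open>Volume and counting bounds for one schedule\<close>

text \<open>In its last active slot \<open>m\<close> the job is still incomplete although its
  predecessors are done, so all it received up to \<open>m\<close> is at most its requirement.
  Processing beyond the requirement can occur only from the completing slot on.\<close>

lemma active_volume_le_proc:
  assumes R: "schedule I R" and p: "0 \<le> proc I v"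
  shows "(\<Sum>t | t \<in> {1..T} \<and> v \<in> active I R t. R v t) \<le> proc I v"
proof (cases "{t \<in> {1..T}. v \<in> active I R t} = {}")
  case True
  then show ?thesis using p by (simp only: sum.empty)
next
  case False
  let ?S = "{t \<in> {1..T}. v \<in> active I R t}"
  define m where "m = Max ?S"
  have m: "m \<in> ?S" unfolding m_def using False by (intro Max_in) auto
  have "(\<Sum>t\<in>?S. R v t) \<le> (\<Sum>t\<in>{1..m}. R v t)"
    using R by (intro sum_mono2) (auto simp: m_def schedule_def)
  also have "\<dots> \<le> proc I v"
  proof (rule ccontr)
    assume less: "\<not> ?thesis"
    have "completion_time I R v \<le> enat m"
    proof (rule completion_time_le_if_preds[OF R])
      show "completion_time I R i \<le> enat m" if "(i, v) \<in> prec I" for i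
        using m that by (auto simp: active_def front_def intro: less_imp_le)
      show "proc I v \<le> (\<Sum>s\<in>{1..m}. R v s)" using less by linarith
    qed
    with m show False by (auto simp: active_def)
  qed
  finally show ?thesis .
qed

text \<open>A job without requirement completes together with its last predecessor, that is by
  \<open>t - 1\<close> if it is a front job at \<open>t\<close>.\<close>

lemma completing_proc_pos:
  assumes R: "schedule I R" and v: "v \<in> completing I R t" and t: "1 \<le> t"
  shows "0 < proc I v"
proof (rule ccontr)
  assume neg: "\<not> 0 < proc I v"
  have "completion_time I R v \<le> enat (t - 1)"
  proof (rule completion_time_le_if_preds[OF R])
    fix i assume "(i, v) \<in> prec I"
    then have "completion_time I R i < enat t" using v by (auto simp: completing_def front_def)
    then show "completion_time I R i \<le> enat (t - 1)"
      using t by (cases "completion_time I R i") auto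
  next
    have "0 \<le> (\<Sum>s\<in>{1..t - 1}. R v s)"
      using R by (intro sum_nonneg) (auto simp: schedule_def)
    then show "proc I v \<le> (\<Sum>s\<in>{1..t - 1}. R v s)" using neg by linarith
  qed
  with v t show False by (auto simp: completing_def)
qed

text \<open>The counted ancestors form a chain, and positive requirements make their completion
  times distinct values in \<open>{1..c}\<close>. The counted set depends on the instance only,
  which permits a comparison of two schedules.\<close>

lemma card_pos_ancestors_le:
  assumes f: "out_forest I" and R: "schedule I R" and C: "completion_time I R u = enat c"
  shows "finite {v. (v, u) \<in> (prec I)\<^sup>* \<and> 0 < proc I v}"
    and "card {v. (v, u) \<in> (prec I)\<^sup>* \<and> 0 < proc I v} \<le> c"
proof -
  let ?A = "{v. (v, u) \<in> (prec I)\<^sup>* \<and> 0 < proc I v}"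
  have le: "completion_time I R v \<le> enat c" if "v \<in> ?A" for v
    using completion_time_mono[of v u I R] that C by simp
  have inj: "inj_on (completion_time I R) ?A"
  proof (rule inj_onI, rule ccontr)
    fix v v' assume v: "v \<in> ?A" "v' \<in> ?A" "completion_time I R v = completion_time I R v'" "v \<noteq> v'"
    have "(v, v') \<in> (prec I)\<^sup>+ \<or> (v', v) \<in> (prec I)\<^sup>+"
      using out_forest_ancestors_comparable[OF f, of v u v'] v by (auto simp: rtrancl_eq_or_trancl)
    moreover have "completion_time I R v \<noteq> \<infinity>" "completion_time I R v' \<noteq> \<infinity>"
      using le[OF v(1)] le[OF v(2)] by (auto dest!: enat_ile)
    ultimately show False
      using completion_time_strict_mono[OF R] v by (metis (mono_tags, lifting) less_irrefl mem_Collect_eq)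
  qed
  have sub: "completion_time I R ` ?A \<subseteq> enat ` {1..c}"
  proof
    fix x assume "x \<in> completion_time I R ` ?A"
    then obtain v where v: "v \<in> ?A" "x = completion_time I R v" by blast
    obtain n where n: "x = enat n" using le[OF v(1)] v(2) by (auto dest: enat_ile)
    then have "n \<le> c" using le[OF v(1)] v(2) by simp
    have "n \<noteq> 0"
    proof
      assume "n = 0"
      then have "proc I v \<le> (\<Sum>s\<in>{1..0}. R v s)"
        using completion_time_le_iff[OF R, of v 0] v n by auto
      with v show False by simp
    qed
    with n \<open>n \<le> c\<close> show "x \<in> enat ` {1..c}" by auto
  qed
  have "finite (completion_time I R ` ?A)" using sub by (rule finite_subset) simp
  then show "finite ?A" using inj by (rule finite_imageD)
  have "card ?A = card (completion_time I R ` ?A)" using inj by (rule card_image[symmetric])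
  also have "\<dots> \<le> card (enat ` {1..c})" using sub by (intro card_mono) simp_all
  also have "\<dots> = c" by (simp add: card_image inj_on_def)
  finally show "card ?A \<le> c" .
qed

text \<open>All these jobs receive their full requirement within the first \<open>c\<close> slots,
  each of capacity 1.\<close>

lemma volume_before_le:
  assumes val: "valid_instance I" and R: "schedule I R" and C: "completion_time I R u = enat c"
  shows "(\<Sum>v | v \<in> jobs I \<and> completion_time I R v \<le> completion_time I R u. proc I v) \<le> real c"
proof -
  let ?D = "{v. v \<in> jobs I \<and> completion_time I R v \<le> completion_time I R u}"
  have fin: "finite (jobs I)" using val by (simp add: valid_instance_def)
  have "(\<Sum>v\<in>?D. proc I v) \<le> (\<Sum>v\<in>?D. \<Sum>s\<in>{1..c}. R v s)"
    using completion_time_le_iff[OF R, of _ c] C by (intro sum_mono) auto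
  also have "\<dots> = (\<Sum>s\<in>{1..c}. \<Sum>v\<in>?D. R v s)" by (rule sum.swap)
  also have "\<dots> \<le> (\<Sum>s\<in>{1..c}. \<Sum>v\<in>jobs I. R v s)"
    using R fin by (intro sum_mono sum_mono2) (auto simp: schedule_def)
  also have "\<dots> \<le> (\<Sum>s\<in>{1..c}. 1)"
    using R by (intro sum_mono) (auto simp: schedule_def)
  finally show ?thesis by simp
qed

section \<open>Charging the algorithm to a competing schedule\<close>

text \<open>Each product in the expanded square has its indices ordered by \<open>c\<close> in at
  least one direction, and the two directions contribute equally.\<close>

lemma sum_power2_le_ordered_pairs:
  fixes x :: "'a \<Rightarrow> real" and c :: "'a \<Rightarrow> 'b::linorder"
  assumes "finite X" and "\<And>v. v \<in> X \<Longrightarrow> 0 \<le> x v"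
  shows "(\<Sum>v\<in>X. x v)\<^sup>2 \<le> 2 * (\<Sum>v\<in>X. x v * (\<Sum>u | u \<in> X \<and> c v \<le> c u. x u))"
proof -
  let ?P = "\<lambda>v u. if c v \<le> c u then x v * x u else 0"
  have inner: "x v * (\<Sum>u | u \<in> X \<and> c v \<le> c u. x u) = (\<Sum>u\<in>X. ?P v u)" for v
    using assms(1) by (auto simp: sum_distrib_left sum.If_cases Int_def intro: sum.cong)
  have "(\<Sum>v\<in>X. x v)\<^sup>2 = (\<Sum>v\<in>X. \<Sum>u\<in>X. x v * x u)"
    by (simp add: power2_eq_square sum_product)
  also have "\<dots> \<le> (\<Sum>v\<in>X. \<Sum>u\<in>X. ?P v u + ?P u v)"
    using assms(2) by (intro sum_mono) auto
  also have "\<dots> = (\<Sum>v\<in>X. \<Sum>u\<in>X. ?P v u) + (\<Sum>v\<in>X. \<Sum>u\<in>X. ?P u v)"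
    by (simp add: sum.distrib)
  also have "(\<Sum>v\<in>X. \<Sum>u\<in>X. ?P u v) = (\<Sum>v\<in>X. \<Sum>u\<in>X. ?P v u)"
    by (rule sum.swap)
  finally show ?thesis by (simp add: inner)
qed

text \<open>Exchange the sums: \<open>u\<close> is counted in the slots in which \<open>R\<close>
  completes one of its ancestors. All these ancestors have positive requirement, and their number is
  at most the completion time of \<open>u\<close> under \<open>Q\<close>.\<close>

lemma completing_weight_le:
  assumes f: "out_forest I" and R: "schedule I R" and Q: "schedule I Q"
    and fin: "\<And>u. u \<in> jobs I \<Longrightarrow> 0 < weight I u \<Longrightarrow> completion_time I Q u \<noteq> \<infinity>"
  shows "(\<Sum>t\<in>{1..T}. \<Sum>v\<in>completing I R t. total_weight I (succs I v)) \<le>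
    (\<Sum>u\<in>jobs I. weight I u * real (the_enat (completion_time I Q u)))"
proof -
  have val: "valid_instance I" using f by (simp add: out_forest_def)
  then have finJ: "finite (jobs I)" by (simp add: valid_instance_def)
  let ?L = "\<lambda>t. \<Union>v\<in>completing I R t. succs I v"
  have LJ: "?L t \<subseteq> jobs I" for t
    using succs_subset_jobs[OF val] by (fastforce simp: completing_def front_def)
  have "(\<Sum>t\<in>{1..T}. \<Sum>v\<in>completing I R t. total_weight I (succs I v)) =
      (\<Sum>t\<in>{1..T}. total_weight I (?L t))"
    by (intro sum.cong refl total_weight_UN_succs[OF f, symmetric]) (auto simp: completing_def)
  also have "\<dots> = (\<Sum>t\<in>{1..T}. \<Sum>u\<in>jobs I. if u \<in> ?L t then weight I u else 0)"
    unfolding total_weight_def using LJ finJ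
    by (intro sum.cong[OF refl, of "{1..T}"] sum.mono_neutral_cong_left) auto
  also have "\<dots> = (\<Sum>u\<in>jobs I. \<Sum>t\<in>{1..T}. if u \<in> ?L t then weight I u else 0)"
    by (rule sum.swap)
  also have "\<dots> \<le> (\<Sum>u\<in>jobs I. weight I u * real (the_enat (completion_time I Q u)))"
  proof (rule sum_mono)
    fix u assume u: "u \<in> jobs I"
    let ?S = "{t \<in> {1..T}. u \<in> ?L t}"
    let ?A = "{v. (v, u) \<in> (prec I)\<^sup>* \<and> 0 < proc I v}"
    have eq: "(\<Sum>t\<in>{1..T}. if u \<in> ?L t then weight I u else 0) = real (card ?S) * weight I u"
      by (simp add: sum.inter_filter[symmetric] del: UN_iff)
    show "(\<Sum>t\<in>{1..T}. if u \<in> ?L t then weight I u else 0) \<le>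
        weight I u * real (the_enat (completion_time I Q u))"
    \<comment> \<open>A job of weight 0 may never complete under \<open>Q\<close>; the factor 0 then
      removes the unspecified value \<open>the_enat \<infinity>\<close>.\<close>
    proof (cases "0 < weight I u")
      case False
      then have "weight I u = 0" using u val by (force simp: valid_instance_def)
      then show ?thesis unfolding eq by simp
    next
      case True
      then obtain c where c: "completion_time I Q u = enat c" using fin[OF u] by auto
      have "?S \<subseteq> (\<lambda>v. the_enat (completion_time I R v)) ` ?A"
      proof
        fix t assume t: "t \<in> ?S"
        then obtain v where v: "v \<in> completing I R t" "u \<in> succs I v" by auto
        then have "v \<in> ?A" using completing_proc_pos[OF R] t by (auto simp: succs_def)
        moreover have "t = the_enat (completion_time I R v)" using v by (simp add: completing_def)
        ultimately show "t \<in> (\<lambda>v. the_enat (completion_time I R v)) ` ?A" by blast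
      qed
      then have "card ?S \<le> card ?A"
        using card_pos_ancestors_le(1)[OF f Q c] by (rule surj_card_le[rotated])
      also have "\<dots> \<le> c" by (rule card_pos_ancestors_le(2)[OF f Q c])
      finally show ?thesis unfolding eq using True c by (simp add: mult.commute)
    qed
  qed
  finally show ?thesis .
qed

lemma active_weight_le:
  assumes f: "out_forest I" and R: "schedule I R" and Q: "schedule I Q" and \<rho>: "0 \<le> \<rho>"
    and rate: "\<And>t j. 1 \<le> t \<Longrightarrow> j \<in> front I R t \<Longrightarrow>
      total_weight I (succs I j) \<le> \<rho> * R j t * total_weight I (unfinished I R t)"
    and fin: "\<And>u. u \<in> jobs I \<Longrightarrow> 0 < weight I u \<Longrightarrow> completion_time I Q u \<noteq> \<infinity>"
  shows "(\<Sum>t\<in>{1..T}. (\<Sum>v\<in>active I R t. total_weight I (succs I v))\<^sup>2 /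
      total_weight I (unfinished I R t)) \<le>
    2 * \<rho> * (\<Sum>u\<in>jobs I. weight I u * real (the_enat (completion_time I Q u)))"
proof -
  have val: "valid_instance I" using f by (simp add: out_forest_def)
  then have finJ: "finite (jobs I)" by (simp add: valid_instance_def)
  let ?C = "completion_time I Q"
  let ?W = "\<lambda>t. total_weight I (unfinished I R t)"
  let ?x = "\<lambda>v. total_weight I (succs I v)"
  \<comment> \<open>The weight of \<open>?later v\<close> is what \<open>Q\<close> keeps waiting for
    \<open>v\<close>: summing it against \<open>proc I v\<close> and exchanging the sums gives, for
    each \<open>u\<close>, the volume that \<open>Q\<close> finishes by the completion of
    \<open>u\<close>.\<close>
  let ?later = "\<lambda>v. {u \<in> jobs I. ?C v \<le> ?C u}"
  have activeJ: "active I R t \<subseteq> jobs I" for t by (auto simp: active_def front_def)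
  have W0: "0 \<le> ?W t" for t
    unfolding unfinished_eq[OF val] by (rule total_weight_nonneg[OF val]) auto
  have x0: "0 \<le> ?x v" if "v \<in> jobs I" for v
    using total_weight_nonneg[OF val succs_subset_jobs[OF val that]] .
  have later0: "0 \<le> total_weight I (?later v)" for v
    by (rule total_weight_nonneg[OF val]) auto
  have slot: "(\<Sum>v\<in>active I R t. ?x v)\<^sup>2 / ?W t \<le>
      2 * \<rho> * (\<Sum>v\<in>active I R t. R v t * total_weight I (?later v))" if t: "1 \<le> t" for t
  proof -
    have R0: "0 \<le> R v t" for v using R t by (auto simp: schedule_def)
    have nonneg: "0 \<le> 2 * \<rho> * (\<Sum>v\<in>active I R t. R v t * total_weight I (?later v))"
      using \<rho> later0 R0 by (intro mult_nonneg_nonneg sum_nonneg) auto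
    have "(\<Sum>v\<in>active I R t. ?x v)\<^sup>2 \<le>
        2 * (\<Sum>v\<in>active I R t. ?x v * (\<Sum>u | u \<in> active I R t \<and> ?C v \<le> ?C u. ?x u))"
      using finJ activeJ x0 by (intro sum_power2_le_ordered_pairs) (auto intro: finite_subset)
    \<comment> \<open>The first factor is bounded by the rate condition. For the second, the
      subtrees are disjoint, and under \<open>Q\<close> a descendant completes no earlier than its
      ancestor, so they all lie in \<open>?later v\<close>.\<close>
    also have "\<dots> \<le> 2 * (\<Sum>v\<in>active I R t. (\<rho> * R v t * ?W t) * total_weight I (?later v))"
    proof (intro mult_left_mono sum_mono mult_mono)
      fix v assume v: "v \<in> active I R t"
      let ?X = "{u \<in> active I R t. ?C v \<le> ?C u}"
      show "?x v \<le> \<rho> * R v t * ?W t" using rate[OF t] v by (auto simp: active_def)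
      show "0 \<le> \<rho> * R v t * ?W t" using \<rho> R0 W0 by simp
      have XJ: "?X \<subseteq> jobs I" using activeJ by auto
      then show "0 \<le> (\<Sum>u\<in>?X. ?x u)" using x0 by (intro sum_nonneg) auto
      have "(\<Sum>u\<in>?X. ?x u) = total_weight I (\<Union>u\<in>?X. succs I u)"
        by (rule total_weight_UN_succs[OF f, of _ R t, symmetric]) (auto simp: active_def)
      also have "\<dots> \<le> total_weight I (?later v)"
      proof (rule total_weight_mono[OF val])
        show "(\<Union>u\<in>?X. succs I u) \<subseteq> ?later v"
        proof
          fix y assume "y \<in> (\<Union>u\<in>?X. succs I u)"
          then obtain u where u: "u \<in> ?X" "y \<in> succs I u" by blast
          then have "?C u \<le> ?C y" by (intro completion_time_mono) (auto simp: succs_def)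
          moreover have "y \<in> jobs I" using u XJ succs_subset_jobs[OF val] by blast
          ultimately show "y \<in> ?later v" using u by auto
        qed
      qed auto
      finally show "(\<Sum>u\<in>?X. ?x u) \<le> total_weight I (?later v)" .
    qed auto
    also have "\<dots> = 2 * \<rho> * (\<Sum>v\<in>active I R t. R v t * total_weight I (?later v)) * ?W t"
      by (simp add: sum_distrib_left sum_distrib_right mult_ac)
    \<comment> \<open>If the unfinished weight is 0, the quotient is 0 by convention and
      nonnegativity suffices.\<close>
    finally show ?thesis
      using nonneg W0[of t] by (cases "?W t = 0") (auto simp: pos_divide_le_eq)
  qed
  have "(\<Sum>t\<in>{1..T}. \<Sum>v\<in>active I R t. R v t * total_weight I (?later v)) =
      (\<Sum>t\<in>{1..T}. \<Sum>v\<in>jobs I. if v \<in> active I R t then R v t * total_weight I (?later v) else 0)"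
    using activeJ finJ
    by (intro sum.cong[OF refl, of "{1..T}"] sum.mono_neutral_cong_left) auto
  also have "\<dots> = (\<Sum>v\<in>jobs I. \<Sum>t\<in>{1..T}. if v \<in> active I R t then R v t * total_weight I (?later v) else 0)"
    by (rule sum.swap)
  also have "\<dots> = (\<Sum>v\<in>jobs I. (\<Sum>t | t \<in> {1..T} \<and> v \<in> active I R t. R v t) * total_weight I (?later v))"
    by (intro sum.cong refl) (simp only: sum.inter_filter[symmetric] sum_distrib_right finite_atLeastAtMost)
  \<comment> \<open>The restriction to active slots pays off here: the processing counted for
    \<open>v\<close> never exceeds its requirement.\<close>
  also have "\<dots> \<le> (\<Sum>v\<in>jobs I. proc I v * total_weight I (?later v))"
    using val later0
    by (intro sum_mono mult_right_mono active_volume_le_proc[OF R]) (auto simp: valid_instance_def)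
  also have "\<dots> = (\<Sum>v\<in>jobs I. \<Sum>u\<in>jobs I. if ?C v \<le> ?C u then proc I v * weight I u else 0)"
    unfolding total_weight_def
    by (intro sum.cong refl) (simp only: sum.inter_filter[symmetric] sum_distrib_left finJ)
  also have "\<dots> = (\<Sum>u\<in>jobs I. \<Sum>v\<in>jobs I. if ?C v \<le> ?C u then proc I v * weight I u else 0)"
    by (rule sum.swap)
  also have "\<dots> = (\<Sum>u\<in>jobs I. (\<Sum>v | v \<in> jobs I \<and> ?C v \<le> ?C u. proc I v) * weight I u)"
    by (intro sum.cong refl) (simp only: sum.inter_filter[symmetric] sum_distrib_right finJ)
  also have "\<dots> \<le> (\<Sum>u\<in>jobs I. weight I u * real (the_enat (?C u)))"
  proof (rule sum_mono)
    fix u assume u: "u \<in> jobs I"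
    show "(\<Sum>v | v \<in> jobs I \<and> ?C v \<le> ?C u. proc I v) * weight I u \<le> weight I u * real (the_enat (?C u))"
    proof (cases "0 < weight I u")
      case False
      then have "weight I u = 0" using u val by (force simp: valid_instance_def)
      then show ?thesis by simp
    next
      case True
      then obtain c where c: "?C u = enat c" using fin[OF u] by auto
      show ?thesis
        using volume_before_le[OF val Q c] True by (simp add: c mult.commute)
    qed
  qed
  finally have total: "(\<Sum>t\<in>{1..T}. \<Sum>v\<in>active I R t. R v t * total_weight I (?later v)) \<le>
      (\<Sum>u\<in>jobs I. weight I u * real (the_enat (?C u)))" .
  have "(\<Sum>t\<in>{1..T}. (\<Sum>v\<in>active I R t. ?x v)\<^sup>2 / ?W t) \<le>
      (\<Sum>t\<in>{1..T}. 2 * \<rho> * (\<Sum>v\<in>active I R t. R v t * total_weight I (?later v)))"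
    by (intro sum_mono slot) auto
  also have "\<dots> = 2 * \<rho> * (\<Sum>t\<in>{1..T}. \<Sum>v\<in>active I R t. R v t * total_weight I (?later v))"
    by (simp add: sum_distrib_left)
  also have "\<dots> \<le> 2 * \<rho> * (\<Sum>u\<in>jobs I. weight I u * real (the_enat (?C u)))"
    using total \<rho> by (intro mult_left_mono) auto
  finally show ?thesis .
qed

section \<open>Combining both charges\<close>

lemma unfinished_weight_split:
  assumes f: "out_forest I"
  shows "total_weight I (unfinished I R t) =
    (\<Sum>v\<in>active I R t. total_weight I (succs I v)) +
    (\<Sum>v\<in>completing I R t. total_weight I (succs I v))"
proof -
  have fin: "finite (front I R t)"
    using f by (auto simp: out_forest_def valid_instance_def front_def)
  have "total_weight I (unfinished I R t) = (\<Sum>v\<in>front I R t. total_weight I (succs I v))"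
    unfolding unfinished_def by (rule total_weight_UN_succs[OF f subset_refl])
  also have "front I R t = active I R t \<union> completing I R t"
    by (auto simp: active_def completing_def front_def order_le_less)
  also have "(\<Sum>v\<in>\<dots>. total_weight I (succs I v)) =
      (\<Sum>v\<in>active I R t. total_weight I (succs I v)) +
      (\<Sum>v\<in>completing I R t. total_weight I (succs I v))"
    using fin by (intro sum.union_disjoint) (auto simp: active_def completing_def)
  finally show ?thesis .
qed

text \<open>Sum the rate condition over the front jobs: the subtree weights add up to the whole
  unfinished weight, which cancels, and the rates add up to at most 1.\<close>

lemma rate_factor_ge_1:
  assumes f: "out_forest I" and R: "schedule I R" and t: "1 \<le> t"
    and rate: "\<And>j. j \<in> front I R t \<Longrightarrow>
      total_weight I (succs I j) \<le> \<rho> * R j t * total_weight I (unfinished I R t)"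
    and pos: "0 < total_weight I (unfinished I R t)"
  shows "1 \<le> \<rho>"
proof -
  let ?W = "total_weight I (unfinished I R t)"
  have finJ: "finite (jobs I)" using f by (simp add: out_forest_def valid_instance_def)
  have R0: "0 \<le> R v t" for v using R t by (auto simp: schedule_def)
  have "?W = (\<Sum>v\<in>front I R t. total_weight I (succs I v))"
    unfolding unfinished_def by (rule total_weight_UN_succs[OF f subset_refl])
  also have "\<dots> \<le> (\<Sum>v\<in>front I R t. \<rho> * R v t * ?W)"
    by (intro sum_mono rate)
  also have "\<dots> = \<rho> * (\<Sum>v\<in>front I R t. R v t) * ?W"
    by (simp add: sum_distrib_left sum_distrib_right)
  finally have ge: "1 \<le> \<rho> * (\<Sum>v\<in>front I R t. R v t)" using pos by simp
  have "(\<Sum>v\<in>front I R t. R v t) \<le> (\<Sum>v\<in>jobs I. R v t)"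
    using finJ R0 by (intro sum_mono2) (auto simp: front_def)
  also have "\<dots> \<le> 1" using R t by (auto simp: schedule_def)
  finally have le: "(\<Sum>v\<in>front I R t. R v t) \<le> 1" .
  have "0 \<le> (\<Sum>v\<in>front I R t. R v t)" using R0 by (intro sum_nonneg) auto
  then have "0 \<le> \<rho>" using ge by (smt (verit) mult_nonpos_nonneg)
  then show ?thesis using ge le by (smt (verit) mult_left_le)
qed

lemma sum_unfinished_weight_le:
  assumes f: "out_forest I" and R: "schedule I R" and Q: "schedule I Q" and \<rho>: "1 \<le> \<rho>"
    and rate: "\<And>t j. 1 \<le> t \<Longrightarrow> j \<in> front I R t \<Longrightarrow>
      total_weight I (succs I j) \<le> \<rho> * R j t * total_weight I (unfinished I R t)"
    and fin: "\<And>u. u \<in> jobs I \<Longrightarrow> 0 < weight I u \<Longrightarrow> completion_time I Q u \<noteq> \<infinity>"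
  shows "(\<Sum>t\<in>{1..T}. total_weight I (unfinished I R t)) \<le>
    4 * \<rho> * (\<Sum>u\<in>jobs I. weight I u * real (the_enat (completion_time I Q u)))"
proof -
  have val: "valid_instance I" using f by (simp add: out_forest_def)
  let ?W = "\<lambda>t. total_weight I (unfinished I R t)"
  let ?N = "\<lambda>t. \<Sum>v\<in>active I R t. total_weight I (succs I v)"
  let ?L = "\<lambda>t. \<Sum>v\<in>completing I R t. total_weight I (succs I v)"
  let ?O = "\<Sum>u\<in>jobs I. weight I u * real (the_enat (completion_time I Q u))"
  have O0: "0 \<le> ?O" using val by (intro sum_nonneg) (auto simp: valid_instance_def)
  have W0: "0 \<le> ?W t" for t
    unfolding unfinished_eq[OF val] by (rule total_weight_nonneg[OF val]) auto
  have L0: "0 \<le> ?L t" for t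
    by (intro sum_nonneg total_weight_nonneg[OF val] succs_subset_jobs[OF val])
      (auto simp: completing_def front_def)
  have "?W t \<le> (?N t)\<^sup>2 / ?W t + 2 * ?L t" for t
  proof (cases "?W t = 0")
    case True
    then show ?thesis using L0[of t] by simp
  next
    case False
    \<comment> \<open>The right side exceeds the left by exactly
      \<open>l\<^sup>2 / (n + l)\<close>.\<close>
    have "(n + l) \<le> n\<^sup>2 / (n + l) + 2 * l" if "0 < n + l" for n l :: real
    proof -
      have "n\<^sup>2 / (n + l) + 2 * l = (n + l) + l\<^sup>2 / (n + l)"
        using that by (simp add: field_simps power2_eq_square)
      then show ?thesis using that by simp
    qed
    from this[of "?N t" "?L t"] show ?thesis
      using False W0[of t] by (simp add: unfinished_weight_split[OF f, of R t])
  qed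
  then have "(\<Sum>t\<in>{1..T}. ?W t) \<le> (\<Sum>t\<in>{1..T}. (?N t)\<^sup>2 / ?W t + 2 * ?L t)"
    by (rule sum_mono)
  also have "\<dots> = (\<Sum>t\<in>{1..T}. (?N t)\<^sup>2 / ?W t) + 2 * (\<Sum>t\<in>{1..T}. ?L t)"
    by (simp add: sum.distrib sum_distrib_left)
  also have "\<dots> \<le> 2 * \<rho> * ?O + 2 * ?O"
  proof (rule add_mono)
    show "(\<Sum>t\<in>{1..T}. (?N t)\<^sup>2 / ?W t) \<le> 2 * \<rho> * ?O"
      using \<rho> by (intro active_weight_le[OF f R Q _ rate fin]) linarith
    show "2 * (\<Sum>t\<in>{1..T}. ?L t) \<le> 2 * ?O"
      by (intro mult_left_mono completing_weight_le[OF f R Q fin]) simp_all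
  qed
  also have "\<dots> \<le> 4 * \<rho> * ?O"
    using mult_right_mono[OF \<rho> O0] by (simp add: algebra_simps)
  finally show ?thesis .
qed

section \<open>From sums over time to costs and the optimum\<close>

lemma cost_eq_ennreal:
  assumes val: "valid_instance I"
    and fin: "\<And>u. u \<in> jobs I \<Longrightarrow> 0 < weight I u \<Longrightarrow> completion_time I Q u \<noteq> \<infinity>"
  shows "cost I Q = ennreal (\<Sum>u\<in>jobs I. weight I u * real (the_enat (completion_time I Q u)))"
proof -
  have w0: "0 \<le> weight I u" if "u \<in> jobs I" for u using val that by (simp add: valid_instance_def)
  have "ennreal (weight I u) * ennreal_of_enat (completion_time I Q u) =
      ennreal (weight I u * real (the_enat (completion_time I Q u)))" if u: "u \<in> jobs I" for u
  proof (cases "0 < weight I u")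
    case False
    then show ?thesis using w0[OF u] by simp
  next
    case True
    then obtain c where "completion_time I Q u = enat c" using fin[OF u] by auto
    then show ?thesis using w0[OF u] by (simp add: ennreal_mult ennreal_of_nat_eq_real_of_nat)
  qed
  then have "cost I Q = (\<Sum>u\<in>jobs I. ennreal (weight I u * real (the_enat (completion_time I Q u))))"
    unfolding cost_def by (intro sum.cong) auto
  also have "\<dots> = ennreal (\<Sum>u\<in>jobs I. weight I u * real (the_enat (completion_time I Q u)))"
    using w0 by (intro sum_ennreal) auto
  finally show ?thesis .
qed

text \<open>A job with completion time \<open>c\<close> is unfinished in exactly the slots
  \<open>1..c\<close>, so summing the unfinished weight over time gives the cost. A bound uniform in
  \<open>T\<close> also forces every job of positive weight to complete.\<close>

lemma cost_le_if_sum_unfinished_weight_le: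
  assumes val: "valid_instance I"
    and le: "\<And>T. (\<Sum>t\<in>{1..T}. total_weight I (unfinished I R t)) \<le> B"
  shows "cost I R \<le> ennreal B"
proof -
  have finJ: "finite (jobs I)" using val by (simp add: valid_instance_def)
  have w0: "0 \<le> weight I u" if "u \<in> jobs I" for u using val that by (simp add: valid_instance_def)
  let ?C = "completion_time I R"
  let ?k = "\<lambda>T u. card {t \<in> {1..T}. enat t \<le> ?C u}"
  have sum_eq: "(\<Sum>t\<in>{1..T}. total_weight I (unfinished I R t)) =
      (\<Sum>u\<in>jobs I. weight I u * real (?k T u))" for T
  proof -
    have "(\<Sum>t\<in>{1..T}. total_weight I (unfinished I R t)) =
        (\<Sum>t\<in>{1..T}. \<Sum>u\<in>jobs I. if enat t \<le> ?C u then weight I u else 0)"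
      unfolding unfinished_eq[OF val] total_weight_def using finJ
      by (simp only: sum.inter_filter[symmetric])
    also have "\<dots> = (\<Sum>u\<in>jobs I. \<Sum>t\<in>{1..T}. if enat t \<le> ?C u then weight I u else 0)"
      by (rule sum.swap)
    also have "\<dots> = (\<Sum>u\<in>jobs I. weight I u * real (?k T u))"
      by (simp add: sum.inter_filter[symmetric] mult.commute)
    finally show ?thesis .
  qed
  have bound: "(\<Sum>u\<in>jobs I. weight I u * real (?k T u)) \<le> B" for T
    using le[of T] sum_eq[of T] by simp
  have finite_C: "?C u \<noteq> \<infinity>" if u: "u \<in> jobs I" "0 < weight I u" for u
  proof
    assume inf: "?C u = \<infinity>"
    obtain T :: nat where T: "B / weight I u < real T" using reals_Archimedean2 by blast
    have "weight I u * real (?k T u) \<le> (\<Sum>u\<in>jobs I. weight I u * real (?k T u))"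
      using u finJ w0 by (intro member_le_sum) auto
    also have "\<dots> \<le> B" by (rule bound)
    also have "{t \<in> {1..T}. enat t \<le> ?C u} = {1..T}" using inf by auto
    finally have "weight I u * real T \<le> B" by simp
    then show False using T u by (simp add: field_simps)
  qed
  \<comment> \<open>A horizon beyond all finite completion times; inserting 0 covers an empty job
    set.\<close>
  define T where "T = Max (insert 0 ((\<lambda>u. the_enat (?C u)) ` jobs I))"
  have "weight I u * real (the_enat (?C u)) \<le> weight I u * real (?k T u)" if u: "u \<in> jobs I" for u
  proof (cases "0 < weight I u")
    case False
    then show ?thesis using w0[OF u] by simp
  next
    case True
    then obtain c where c: "?C u = enat c" using finite_C[OF u] by auto
    have "c \<le> T" unfolding T_def using finJ u c by (intro Max_ge) (auto intro!: image_eqI[of _ _ u])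
    then have "{t \<in> {1..T}. enat t \<le> ?C u} = {1..c}" using c by auto
    then show ?thesis using c by simp
  qed
  then have "(\<Sum>u\<in>jobs I. weight I u * real (the_enat (?C u))) \<le> B"
    using bound[of T] by (meson order_trans sum_mono)
  then show ?thesis using cost_eq_ennreal[OF val finite_C] by (simp add: ennreal_leI)
qed

lemma cost_le_cost:
  assumes f: "out_forest I" and R: "schedule I R" and Q: "schedule I Q" and \<rho>: "1 \<le> \<rho>"
    and rate: "\<And>t j. 1 \<le> t \<Longrightarrow> j \<in> front I R t \<Longrightarrow>
      total_weight I (succs I j) \<le> \<rho> * R j t * total_weight I (unfinished I R t)"
  shows "cost I R \<le> ennreal (4 * \<rho>) * cost I Q"
proof (cases "\<forall>u\<in>jobs I. 0 < weight I u \<longrightarrow> completion_time I Q u \<noteq> \<infinity>")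
  case True
  have val: "valid_instance I" using f by (simp add: out_forest_def)
  have fin: "\<And>u. u \<in> jobs I \<Longrightarrow> 0 < weight I u \<Longrightarrow> completion_time I Q u \<noteq> \<infinity>"
    using True by blast
  let ?O = "\<Sum>u\<in>jobs I. weight I u * real (the_enat (completion_time I Q u))"
  have "cost I R \<le> ennreal (4 * \<rho> * ?O)"
    by (intro cost_le_if_sum_unfinished_weight_le[OF val] sum_unfinished_weight_le[OF f R Q \<rho> rate fin])
  also have "\<dots> = ennreal (4 * \<rho>) * cost I Q"
    using cost_eq_ennreal[OF val fin] \<rho> by (simp add: ennreal_mult')
  finally show ?thesis .
next
  case False
  then obtain u where u: "u \<in> jobs I" "0 < weight I u" "completion_time I Q u = \<infinity>" by blast
  have "finite (jobs I)" using f by (simp add: out_forest_def valid_instance_def)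
  then have "ennreal (weight I u) * ennreal_of_enat (completion_time I Q u) \<le> cost I Q"
    unfolding cost_def using u(1) by (intro member_le_sum) auto
  \<comment> \<open>A job of positive weight that \<open>Q\<close> never completes makes the cost of
    \<open>Q\<close> infinite, and the bound is trivial.\<close>
  then have "cost I Q = top" using u by (simp add: ennreal_mult_top top_unique)
  then show ?thesis using \<rho> by (simp add: ennreal_mult_top)
qed

lemma cost_le_opt:
  assumes f: "out_forest I" and R: "schedule I R"
    and rate: "\<And>t j. 1 \<le> t \<Longrightarrow> j \<in> front I R t \<Longrightarrow>
      total_weight I (succs I j) \<le> \<rho> * R j t * total_weight I (unfinished I R t)"
  shows "cost I R \<le> ennreal (4 * \<rho>) * opt I"
proof (cases "\<exists>t\<ge>1. 0 < total_weight I (unfinished I R t)")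
  case True
  then obtain t where t: "1 \<le> t" "0 < total_weight I (unfinished I R t)" by blast
  have \<rho>: "1 \<le> \<rho>" using rate_factor_ge_1[OF f R t(1) rate[OF t(1)] t(2)] .
  \<comment> \<open>Dividing by the factor turns the claim into a lower bound on an infimum, so no
    optimal schedule has to be exhibited.\<close>
  have "cost I R / ennreal (4 * \<rho>) \<le> opt I"
    unfolding opt_def
  proof (rule Inf_greatest)
    fix c assume "c \<in> {cost I Q | Q. schedule I Q}"
    then obtain Q where Q: "c = cost I Q" "schedule I Q" by blast
    have "cost I R \<le> c * ennreal (4 * \<rho>)"
      using cost_le_cost[OF f R Q(2) \<rho> rate] by (simp add: Q(1) mult.commute)
    then have "cost I R / ennreal (4 * \<rho>) \<le> c * ennreal (4 * \<rho>) / ennreal (4 * \<rho>)"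
      by (rule divide_right_mono_ennreal)
    also have "\<dots> = c" using \<rho> by (intro ennreal_mult_divide_eq) auto
    finally show "cost I R / ennreal (4 * \<rho>) \<le> c" .
  qed
  then have "ennreal (4 * \<rho>) * (cost I R / ennreal (4 * \<rho>)) \<le> ennreal (4 * \<rho>) * opt I"
    by (rule mult_left_mono) simp
  also have "ennreal (4 * \<rho>) * (cost I R / ennreal (4 * \<rho>)) = cost I R"
    unfolding ennreal_times_divide mult.commute[of "ennreal (4 * \<rho>)"]
    using \<rho> by (intro ennreal_mult_divide_eq) auto
  finally show ?thesis .
next
  case False
  have val: "valid_instance I" using f by (simp add: out_forest_def)
  \<comment> \<open>Here \<open>\<rho>\<close> may be any real, even negative, but the cost is
    0.\<close>
  have "total_weight I (unfinished I R t) \<le> 0" if "1 \<le> t" for t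
    using False that not_less by blast
  then have "cost I R \<le> ennreal 0"
    by (intro cost_le_if_sum_unfinished_weight_le[OF val] sum_nonpos) simp
  then show ?thesis by simp
qed

theorem theorem4:
  fixes \<I> :: "'j sched_instance set"
    and A :: "'j sched_instance \<Rightarrow> 'j rates"
    and \<rho> :: real
  assumes "\<forall>I\<in>\<I>. out_forest I"
    and "online_algorithm \<I> A"
    and "\<forall>I\<in>\<I>. \<forall>t\<ge>1. \<forall>j\<in>front I (A I) t.
           total_weight I (succs I j) \<le>
             \<rho> * A I j t * total_weight I (unfinished I (A I) t)"
  shows "competitive \<I> A (4 * \<rho>)"
  unfolding competitive_def
proof
  fix I assume I: "I \<in> \<I>"
  have "schedule I (A I)" using assms(2) I by (simp add: online_algorithm_def)
  with assms(1,3) I show "cost I (A I) \<le> ennreal (4 * \<rho>) * opt I"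
    by (intro cost_le_opt) blast+
qed

end
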